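(* Suppose the one-shot problem has a strict local minimizer $(u_0^*,\dots,u_{n-1}^* )$, and let $(x_0^*,\dots,x_n^* )$ be the associated state sequence, i.e. $x_0^*=x_0$ and $x_{k+1}^*=f_k(x_k^*,u_k^* )$. Then there exists a locally minimum control policy $\pi=(\pi_0,\dots,\pi_{n-1})$ of DP such that $\pi_k(x_k^* )=u_k^*$ for all $k\in\{0,\dots,n-1\}$. Moreover, if the strict local minimizer $(u_0^*,\dots,u_{n-1}^* )$ is spurious, then there exists a spurious locally minimum control policy $\pi$ of DP with this property.
   Context: Setting (deterministic optimal control): horizon $n$, states in $\mathbb{R}^N$, compact action space $A\subseteq\mathbb{R}^M$, dynamics $f_k:\mathbb{R}^N\times\mathbb{R}^M\to\mathbb{R}^N$ and stage costs $c_k:\mathbb{R}^N\times\mathbb{R}^M\to\mathbb{R}$ ($k=0,\dots,n-1$), terminal cost $c_n:\mathbb{R}^N\to\mathbb{R}$, all at least twice continuously differentiable; the initial state $x_0$ is given. $B(c,r)$ denotes the open ball with center $c$ and radius $r$. Cost of an input sequence: $C(x)=c_n(x)$ (no inputs), and $C(x;u_k,\dots,u_{n-1})=c_k(x,u_k)+C(f_k(x,u_k);u_{k+1},\dots,u_{n-1})$. The one-shot problem is $\min_{u_0,\dots,u_{n-1}\in A}C(x_0;u_0,\dots,u_{n-1})$, with optimal value denoted $J_0(x_0)$. Strict local minimizer of the one-shot problem: $(u_0^*,\dots,u_{n-1}^* )\in A^n$ such that for some $\epsilon>0$, $C(x_0;u_0^*,\dots,u_{n-1}^* )<C(x_0;u_0,\dots,u_{n-1})$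 for all $(u_0,\dots,u_{n-1})\ne(u_0^*,\dots,u_{n-1}^* )$ with $u_i\in B(u_i^*,\epsilon)\cap A$, $i=0,\dots,n-1$. It is spurious if $C(x_0;u_0^*,\dots,u_{n-1}^* )>J_0(x_0)$. A control policy is $\pi=(\pi_0,\dots,\pi_{n-1})$ with $\pi_k:\mathbb{R}^N\to A$ arbitrary functions. Its Q-functions and cost-to-go functions are defined backward by $J_n^\pi(x)=c_n(x)$, $Q_k^\pi(x,u)=c_k(x,u)+J_{k+1}^\pi(f_k(x,u))$, $J_k^\pi(x)=Q_k^\pi(x,\pi_k(x))$, $k=n-1,\dots,0$. Locally minimum control policy of DP: $\pi$ such that for all $k\in\{0,\dots,n-1\}$ and all $x\in\mathbb{R}^N$ there is $\epsilon_k^*(x)>0$ with $Q_k^\pi(x,\pi_k(x))\le Q_k^\pi(x,\tilde u)$ for all $\tilde u\in B(\pi_k(x),\epsilon_k^*(x))\cap A$. It is spurious if $J_0^\pi(x_0)>J_0(x_0)$. *)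

theory Defs
  imports "HOL-Analysis.Analysis"
begin

definition twice_continuously_differentiable ::
    "('a::real_normed_vector \<Rightarrow> 'b::real_normed_vector) \<Rightarrow> bool" where
  "twice_continuously_differentiable g \<longleftrightarrow>
     (\<exists>(g' :: 'a \<Rightarrow> 'a \<Rightarrow>\<^sub>L 'b) (g'' :: 'a \<Rightarrow> 'a \<Rightarrow>\<^sub>L ('a \<Rightarrow>\<^sub>L 'b)).
        (\<forall>z. (g has_derivative blinfun_apply (g' z)) (at z)) \<and>
        (\<forall>z. (g' has_derivative blinfun_apply (g'' z)) (at z)) \<and>
        continuous_on UNIV g'')"

text \<open>Throughout, \<open>f\<close> is the dynamics, \<open>c\<close> the stage cost, \<open>cN\<close> the terminal cost (\<open>c\<^sub>n\<close>),
  \<open>n\<close> the horizon and \<open>A\<close> the action space.\<close>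

text \<open>Inputs from stage \<open>k\<close> onwards form a list, so \<open>C(x; u\<^sub>k, \<dots>, u\<^sub>n\<^sub>-\<^sub>1)\<close> is
  \<open>cost f c cN k x [u\<^sub>k, \<dots>, u\<^sub>n\<^sub>-\<^sub>1]\<close>, where the list has length \<open>n - k\<close>.\<close>

primrec cost :: "(nat \<Rightarrow> 's \<Rightarrow> 'u \<Rightarrow> 's) \<Rightarrow> (nat \<Rightarrow> 's \<Rightarrow> 'u \<Rightarrow> real) \<Rightarrow> ('s \<Rightarrow> real) \<Rightarrow>
    nat \<Rightarrow> 's \<Rightarrow> 'u list \<Rightarrow> real" where
  "cost f c cN k x [] = cN x"
| "cost f c cN k x (u # us) = c k x u + cost f c cN (Suc k) (f k x u) us"

definition input_seqs :: "nat \<Rightarrow> 'u set \<Rightarrow> 'u list set" where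
  "input_seqs n A = {us. length us = n \<and> set us \<subseteq> A}"

text \<open>The infimum is a minimum when \<open>A\<close> is compact and nonempty and the data are continuous.\<close>

definition optimal_value :: "nat \<Rightarrow> 'u set \<Rightarrow> (nat \<Rightarrow> 's \<Rightarrow> 'u \<Rightarrow> 's) \<Rightarrow>
    (nat \<Rightarrow> 's \<Rightarrow> 'u \<Rightarrow> real) \<Rightarrow> ('s \<Rightarrow> real) \<Rightarrow> 's \<Rightarrow> real" where
  "optimal_value n A f c cN x0 = (INF us\<in>input_seqs n A. cost f c cN 0 x0 us)"

definition strict_local_minimizer :: "nat \<Rightarrow> 'u::metric_space set \<Rightarrow> (nat \<Rightarrow> 's \<Rightarrow> 'u \<Rightarrow> 's) \<Rightarrow>
    (nat \<Rightarrow> 's \<Rightarrow> 'u \<Rightarrow> real) \<Rightarrow> ('s \<Rightarrow> real) \<Rightarrow> 's \<Rightarrow> 'u list \<Rightarrow> bool" where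
  "strict_local_minimizer n A f c cN x0 us \<longleftrightarrow>
     us \<in> input_seqs n A \<and>
     (\<exists>\<epsilon>>0. \<forall>vs. length vs = n \<and> vs \<noteq> us \<and> (\<forall>i<n. vs ! i \<in> ball (us ! i) \<epsilon> \<inter> A) \<longrightarrow>
        cost f c cN 0 x0 us < cost f c cN 0 x0 vs)"

definition spurious_strict_local_minimizer :: "nat \<Rightarrow> 'u::metric_space set \<Rightarrow>
    (nat \<Rightarrow> 's \<Rightarrow> 'u \<Rightarrow> 's) \<Rightarrow> (nat \<Rightarrow> 's \<Rightarrow> 'u \<Rightarrow> real) \<Rightarrow> ('s \<Rightarrow> real) \<Rightarrow> 's \<Rightarrow> 'u list \<Rightarrow> bool" where
  "spurious_strict_local_minimizer n A f c cN x0 us \<longleftrightarrow>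
     strict_local_minimizer n A f c cN x0 us \<and>
     cost f c cN 0 x0 us > optimal_value n A f c cN x0"

text \<open>Only \<open>\<pi> k\<close> for \<open>k < n\<close> is meaningful; values at \<open>k \<ge> n\<close> are never used.\<close>

definition control_policy :: "nat \<Rightarrow> 'u set \<Rightarrow> (nat \<Rightarrow> 's \<Rightarrow> 'u) \<Rightarrow> bool" where
  "control_policy n A \<pi> \<longleftrightarrow> (\<forall>k<n. \<forall>x. \<pi> k x \<in> A)"

function J_policy :: "nat \<Rightarrow> (nat \<Rightarrow> 's \<Rightarrow> 'u \<Rightarrow> 's) \<Rightarrow> (nat \<Rightarrow> 's \<Rightarrow> 'u \<Rightarrow> real) \<Rightarrow> ('s \<Rightarrow> real) \<Rightarrow>
    (nat \<Rightarrow> 's \<Rightarrow> 'u) \<Rightarrow> nat \<Rightarrow> 's \<Rightarrow> real" where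
  "J_policy n f c cN \<pi> k x =
     (if k < n
      then c k x (\<pi> k x) + J_policy n f c cN \<pi> (Suc k) (f k x (\<pi> k x))
      else cN x)"
  by pat_completeness auto
termination
  by (relation "Wellfounded.measure (\<lambda>(n, f, c, cN, \<pi>, k, x). n - k)") auto

declare J_policy.simps [simp del]

definition Q_policy :: "nat \<Rightarrow> (nat \<Rightarrow> 's \<Rightarrow> 'u \<Rightarrow> 's) \<Rightarrow> (nat \<Rightarrow> 's \<Rightarrow> 'u \<Rightarrow> real) \<Rightarrow> ('s \<Rightarrow> real) \<Rightarrow>
    (nat \<Rightarrow> 's \<Rightarrow> 'u) \<Rightarrow> nat \<Rightarrow> 's \<Rightarrow> 'u \<Rightarrow> real" where
  "Q_policy n f c cN \<pi> k x u = c k x u + J_policy n f c cN \<pi> (Suc k) (f k x u)"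

lemma J_policy_terminal: "J_policy n f c cN \<pi> n x = cN x"
  by (simp add: J_policy.simps)

lemma J_policy_step: "k < n \<Longrightarrow> J_policy n f c cN \<pi> k x = Q_policy n f c cN \<pi> k x (\<pi> k x)"
  by (simp add: J_policy.simps [of n f c cN \<pi> k] Q_policy_def)

definition locally_minimum_policy :: "nat \<Rightarrow> 'u::metric_space set \<Rightarrow> (nat \<Rightarrow> 's \<Rightarrow> 'u \<Rightarrow> 's) \<Rightarrow>
    (nat \<Rightarrow> 's \<Rightarrow> 'u \<Rightarrow> real) \<Rightarrow> ('s \<Rightarrow> real) \<Rightarrow> (nat \<Rightarrow> 's \<Rightarrow> 'u) \<Rightarrow> bool" where
  "locally_minimum_policy n A f c cN \<pi> \<longleftrightarrow>
     control_policy n A \<pi> \<and>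
     (\<forall>k<n. \<forall>x. \<exists>\<epsilon>>0. \<forall>v \<in> ball (\<pi> k x) \<epsilon> \<inter> A.
        Q_policy n f c cN \<pi> k x (\<pi> k x) \<le> Q_policy n f c cN \<pi> k x v)"

definition spurious_locally_minimum_policy :: "nat \<Rightarrow> 'u::metric_space set \<Rightarrow>
    (nat \<Rightarrow> 's \<Rightarrow> 'u \<Rightarrow> 's) \<Rightarrow> (nat \<Rightarrow> 's \<Rightarrow> 'u \<Rightarrow> real) \<Rightarrow> ('s \<Rightarrow> real) \<Rightarrow> 's \<Rightarrow>
    (nat \<Rightarrow> 's \<Rightarrow> 'u) \<Rightarrow> bool" where
  "spurious_locally_minimum_policy n A f c cN x0 \<pi> \<longleftrightarrow>
     locally_minimum_policy n A f c cN \<pi> \<and>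
     J_policy n f c cN \<pi> 0 x0 > optimal_value n A f c cN x0"

end

theory Submission
  imports Defs
begin

text \<open>Construct the policy backwards in time. On a small neighbourhood of \<open>x\<^sub>k\<^sup>*\<close> let \<open>\<pi>\<^sub>k\<close> minimize the
  Q-function over the inputs in a small closed ball around \<open>u\<^sub>k\<^sup>*\<close>, elsewhere over all of \<open>A\<close>.
  Minimizers exist because each cost-to-go function is lower semicontinuous: where the policy
  switches, its value can only jump down when leaving the open neighbourhood. On the neighbourhood
  the closed-loop inputs stay close to \<open>u\<^sup>*\<close>, so strict optimality makes \<open>u\<^sub>k\<^sup>*\<close> the unique minimizer
  at \<open>x\<^sub>k\<^sup>*\<close>, and by semicontinuity the minimizers at nearby states avoid the boundary sphere
  of the ball, hence are local minimizers over \<open>A\<close>.\<close>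

section \<open>Lower semicontinuity and attained minima\<close>

text \<open>Lower semicontinuity of \<open>V\<close> is expressed by closedness of the epigraph
  \<open>{(x, a). V x \<le> a}\<close>.\<close>

lemma closed_epigraph_Q:
  fixes f :: "'s::topological_space \<Rightarrow> 'u::topological_space \<Rightarrow> 's" and c :: "'s \<Rightarrow> 'u \<Rightarrow> real"
  assumes f: "continuous_on UNIV (\<lambda>(x, u). f x u)"
    and c: "continuous_on UNIV (\<lambda>(x, u). c x u)"
    and V: "closed {(y, a). V y \<le> a}"
  shows "closed {(u, x, a). c x u + V (f x u) \<le> a}"
proof -
  have swap: "continuous_on UNIV (\<lambda>z::'u \<times> 's \<times> real. (fst (snd z), fst z))"
    by (intro continuous_intros)
  have "continuous_on UNIV (\<lambda>z::'u \<times> 's \<times> real. f (fst (snd z)) (fst z))"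
    using continuous_on_compose2[OF f swap] by simp
  moreover have "continuous_on UNIV (\<lambda>z::'u \<times> 's \<times> real. c (fst (snd z)) (fst z))"
    using continuous_on_compose2[OF c swap] by simp
  \<comment> \<open>The target set is the preimage of the epigraph of \<open>V\<close> under
    \<open>(u, x, a) \<mapsto> (f x u, a - c x u)\<close>. The input comes first so that compact
    sets of inputs can be projected out later.\<close>
  ultimately have "continuous_on UNIV
      (\<lambda>z::'u \<times> 's \<times> real. (f (fst (snd z)) (fst z), snd (snd z) - c (fst (snd z)) (fst z)))"
    by (intro continuous_intros)
  then have "closed ((\<lambda>z::'u \<times> 's \<times> real. (f (fst (snd z)) (fst z), snd (snd z) - c (fst (snd z)) (fst z)))
      -` {(y, a). V y \<le> a})"
    by (rule closed_vimage[OF V])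
  also have "\<dots> = {(u, x, a). c x u + V (f x u) \<le> a}"
    by (auto simp: algebra_simps)
  finally show ?thesis .
qed

text \<open>Without a minimum the open sets \<open>{u. q v < q u}\<close>, \<open>v \<in> K\<close>,
  would cover \<open>K\<close>; but in a finite subcover the index with the least value is covered
  by no member.\<close>

lemma lsc_attains_min:
  fixes q :: "'u::topological_space \<Rightarrow> real"
  assumes "compact K" "K \<noteq> {}" and lsc: "\<And>a. closed {u. q u \<le> a}"
  shows "\<exists>u\<in>K. \<forall>v\<in>K. q u \<le> q v"
proof (rule ccontr)
  assume neg: "\<not> ?thesis"
  have "open {u. q v < q u}" for v
    using lsc[of "q v"] by (simp add: closed_def Compl_eq not_le)
  moreover have "K \<subseteq> (\<Union>v\<in>K. {u. q v < q u})"
    using neg by (auto simp: not_le)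
  ultimately obtain D where D: "D \<subseteq> K" "finite D" "K \<subseteq> (\<Union>v\<in>D. {u. q v < q u})"
    using compactE_image[OF \<open>compact K\<close>, of K "\<lambda>v. {u. q v < q u}"] by blast
  then have "D \<noteq> {}" using \<open>K \<noteq> {}\<close> by auto
  then obtain w where "w \<in> D" "\<And>v. v \<in> D \<Longrightarrow> q w \<le> q v"
    using ex_min_if_finite[of "q ` D"] \<open>finite D\<close> by (force simp: not_less)
  with D show False by force
qed

lemma closed_sections:
  fixes q :: "'s::topological_space \<Rightarrow> 'u::topological_space \<Rightarrow> real"
  assumes "closed {(u, x, a). q x u \<le> a}"
  shows "closed {(u, x). q x u \<le> a}" "closed {u. q x u \<le> a}"
proof -
  have "closed ((\<lambda>z::'u \<times> 's. (fst z, snd z, a)) -` {(u, x, a). q x u \<le> a})"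
    by (intro closed_vimage[OF assms] continuous_intros)
  then show "closed {(u, x). q x u \<le> a}" by (simp add: vimage_def case_prod_unfold)
  have "closed ((\<lambda>u. (u, x, a)) -` {(u, x, a). q x u \<le> a})"
    by (intro closed_vimage[OF assms] continuous_intros)
  then show "closed {u. q x u \<le> a}" by (simp add: vimage_def)
qed

section \<open>The policy at a single stage\<close>

text \<open>One backward step: \<open>V\<close> is the cost-to-go of the next stage, and \<open>T\<close> the cost of
  following the inputs \<open>u\<^sup>*\<close> from there.\<close>

lemma policy_step:
  fixes f :: "'s::euclidean_space \<Rightarrow> 'u::euclidean_space \<Rightarrow> 's" and c :: "'s \<Rightarrow> 'u \<Rightarrow> real"
  assumes A: "compact A" "u0 \<in> A"
    and f: "continuous_on UNIV (\<lambda>(x, u). f x u)"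
    and c: "continuous_on UNIV (\<lambda>(x, u). c x u)"
    and V: "closed {(y, a). V y \<le> a}"
    and T: "continuous_on UNIV T"
    and W: "open W" "f x0 u0 \<in> W" "\<And>y. y \<in> W \<Longrightarrow> V y \<le> T y" "V (f x0 u0) = T (f x0 u0)"
    and r: "r > 0"
    and strict: "\<And>u. u \<in> A \<Longrightarrow> u \<in> ball u0 r \<Longrightarrow> u \<noteq> u0 \<Longrightarrow> f x0 u \<in> W \<Longrightarrow>
      c x0 u0 + V (f x0 u0) < c x0 u + V (f x0 u)"
  shows "\<exists>p U. open U \<and> x0 \<in> U \<and> p x0 = u0 \<and> (\<forall>x. p x \<in> A)
    \<and> (\<forall>x. \<exists>e>0. \<forall>v\<in>ball (p x) e \<inter> A. c x (p x) + V (f x (p x)) \<le> c x v + V (f x v))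
    \<and> closed {(x, a). c x (p x) + V (f x (p x)) \<le> a}
    \<and> (\<forall>x\<in>U. p x \<in> ball u0 r \<and> f x (p x) \<in> W \<and> c x (p x) + V (f x (p x)) \<le> c x u0 + T (f x u0))"
proof -
  define q where "q x u = c x u + V (f x u)" for x u
  have q: "closed {(u, x, a). q x u \<le> a}"
    unfolding q_def by (rule closed_epigraph_Q[OF f c V])
  have attain: "\<exists>u\<in>K. \<forall>v\<in>K. q x u \<le> q x v" if "compact K" "K \<noteq> {}" for K x
    using lsc_attains_min[OF that, of "q x"] closed_sections(2)[OF q] by blast

  have "open ((\<lambda>(x, u). f x u) -` W)" "(x0, u0) \<in> (\<lambda>(x, u). f x u) -` W"
    using open_vimage[OF W(1) f] W(2) by auto
  then have "\<exists>X Y. open X \<and> open Y \<and> (x0, u0) \<in> X \<times> Y \<and> X \<times> Y \<subseteq> (\<lambda>(x, u). f x u) -` W"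
    unfolding open_prod_def by blast
  then obtain X Y where XY: "open X" "open Y" "x0 \<in> X" "u0 \<in> Y" "X \<times> Y \<subseteq> (\<lambda>(x, u). f x u) -` W"
    by blast
  then have XYW: "f x u \<in> W" if "x \<in> X" "u \<in> Y" for x u using that by auto
  have "open (Y \<inter> ball u0 r)" "u0 \<in> Y \<inter> ball u0 r"
    using XY r by auto
  then obtain d where d: "d > 0" "cball u0 d \<subseteq> Y \<inter> ball u0 r"
    using open_contains_cball_eq by blast
  \<comment> \<open>For states in \<open>X\<close> and inputs in \<open>K\<close> the next state
    lies in \<open>W\<close>. A minimizer over \<open>K\<close> that avoids the sphere part
    \<open>S\<close> is a local minimizer over \<open>A\<close>.\<close>
  define K where "K = A \<inter> cball u0 d"
  define S where "S = A \<inter> sphere u0 d"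
  have K: "compact K" "u0 \<in> K" "K \<subseteq> A" "K \<subseteq> Y" "K \<subseteq> ball u0 r" "K - S \<subseteq> ball u0 d"
    using A d by (auto simp: K_def S_def compact_Int)
  have S: "compact S" "S \<subseteq> K" "u0 \<notin> S"
    using A d(1) by (auto simp: K_def S_def compact_Int)
  have strict': "q x0 u0 < q x0 u" if "u \<in> K" "u \<noteq> u0" for u
    unfolding q_def using strict[of u] that K XYW[of x0 u] XY(3) by blast

  \<comment> \<open>The level \<open>m\<close> separates the value at \<open>u0\<close> from the
    values on the sphere. The gap is positive since \<open>q x0\<close> attains its minimum on the
    compact set \<open>S\<close>.\<close>
  obtain m where m: "q x0 u0 < m" "\<And>u. u \<in> S \<Longrightarrow> m < q x0 u"
  proof (cases "S = {}")
    case True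
    then show ?thesis using that[of "q x0 u0 + 1"] by auto
  next
    case False
    then obtain s where s: "s \<in> S" "\<And>u. u \<in> S \<Longrightarrow> q x0 s \<le> q x0 u"
      using attain[OF S(1)] by metis
    have "q x0 u0 < q x0 s" using strict' s(1) S by blast
    then obtain m where "q x0 u0 < m" "m < q x0 s" using dense by blast
    with s(2) show ?thesis using that[of m] by fastforce
  qed
  \<comment> \<open>At states outside \<open>B\<close> every input in \<open>S\<close> costs more
    than \<open>m\<close>. This is an open condition: projecting a closed set along the compact
    \<open>S\<close> gives a closed set.\<close>
  define B where "B = {x. \<exists>u. u \<in> S \<and> (u, x) \<in> {(u, x). q x u \<le> m}}"
  have B: "closed B" "x0 \<notin> B"
    unfolding B_def using closed_compact_projection[OF S(1) closed_sections(1)[OF q]] m(2)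
    by (auto simp: not_le)
  \<comment> \<open>Lower semicontinuity alone does not keep \<open>q x u0\<close> below
    \<open>m\<close> for \<open>x\<close> near \<open>x0\<close>. The continuous function
    \<open>t\<close> does this as an upper bound, since \<open>t x0 = q x0 u0 < m\<close>.\<close>
  define t where "t x = c x u0 + T (f x u0)" for x
  have sec: "continuous_on UNIV (\<lambda>x. (x, u0))" by (intro continuous_intros)
  have "continuous_on UNIV (\<lambda>x. f x u0)" "continuous_on UNIV (\<lambda>x. c x u0)"
    using continuous_on_compose2[OF f sec] continuous_on_compose2[OF c sec] by auto
  then have "continuous_on UNIV t"
    unfolding t_def by (intro continuous_on_add continuous_on_compose2[OF T]) auto
  then have "open {x. t x < m}"
    by (intro open_Collect_less continuous_on_const)
  define U where "U = X \<inter> - B \<inter> {x. t x < m}"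
  have U: "open U" "x0 \<in> U"
    unfolding U_def using \<open>open {x. t x < m}\<close> XY B m(1) W(4)
    by (auto simp: q_def t_def)

  define p where "p x = (let K' = (if x \<in> U then K else A) in SOME u. u \<in> K' \<and> (\<forall>v\<in>K'. q x u \<le> q x v))" for x
  have pU: "p x \<in> K \<and> (\<forall>v\<in>K. q x (p x) \<le> q x v)" if "x \<in> U" for x
    using someI_ex[of "\<lambda>u. u \<in> K \<and> (\<forall>v\<in>K. q x u \<le> q x v)"] attain[of K x] K that
    unfolding p_def by (auto simp: Let_def)
  have pA: "p x \<in> A \<and> (\<forall>v\<in>A. q x (p x) \<le> q x v)" if "x \<notin> U" for x
    using someI_ex[of "\<lambda>u. u \<in> A \<and> (\<forall>v\<in>A. q x u \<le> q x v)"] attain[of A x] A that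
    unfolding p_def by (auto simp: Let_def)
  have p_in: "p x \<in> A" for x using pU pA K by blast
  have qt: "q x (p x) \<le> t x" if "x \<in> U" for x
  proof -
    have "q x (p x) \<le> q x u0" using pU that K by blast
    also have "\<dots> \<le> t x"
      using W(3)[OF XYW[of x u0]] that XY(4) by (auto simp: q_def t_def U_def)
    finally show ?thesis .
  qed
  have "p x \<in> ball u0 d" if "x \<in> U" for x
  proof -
    \<comment> \<open>The minimizer costs at most \<open>t x < m\<close>, whereas off
      \<open>B\<close> every input in \<open>S\<close> costs more than \<open>m\<close>.\<close>
    have "q x (p x) < m" using qt that by (auto simp: U_def intro: le_less_trans)
    then have "p x \<notin> S" using that by (auto simp: U_def B_def)
    then show ?thesis using pU[OF that] K by blast
  qed
  note p_ball = this
  have loc: "\<exists>e>0. \<forall>v\<in>ball (p x) e \<inter> A. q x (p x) \<le> q x v" for x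
  proof (cases "x \<in> U")
    case True
    then obtain e where e: "e > 0" "ball (p x) e \<subseteq> ball u0 d"
      using p_ball[OF True] open_contains_ball_eq[OF open_ball] by blast
    then have "ball (p x) e \<inter> A \<subseteq> K" by (auto simp: K_def subset_eq)
    with e pU[OF True] show ?thesis by blast
  next
    case False
    then show ?thesis using pA[OF False] by (auto intro!: exI[of _ 1])
  qed
  have p0: "p x0 = u0"
    using pU[OF U(2)] K(2) strict'[of "p x0"] by fastforce
  have proj: "closed {z. \<exists>u. u \<in> K' \<and> (u, z) \<in> {(u, x, a). q x u \<le> a}}" if "compact K'" for K'
    by (rule closed_compact_projection[OF that q])
  \<comment> \<open>Some input in \<open>A\<close> must cost at most \<open>a\<close>, and for
    states in \<open>U\<close> even some input in \<open>K\<close>. Since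
    \<open>K \<subseteq> A\<close> this describes the epigraph, and it is a closed condition because
    \<open>- U\<close> is closed.\<close>
  have "closed ({z. \<exists>u. u \<in> A \<and> (u, z) \<in> {(u, x, a). q x u \<le> a}} \<inter>
      ((- U) \<times> UNIV \<union> {z. \<exists>u. u \<in> K \<and> (u, z) \<in> {(u, x, a). q x u \<le> a}}))"
    using proj[OF A(1)] proj[OF K(1)] U by (intro closed_Int closed_Un closed_Times) auto
  also have "\<dots> = {(x, a). q x (p x) \<le> a}"
  proof -
    have "q x (p x) \<le> a \<longleftrightarrow> (\<exists>u\<in>A. q x u \<le> a) \<and> (x \<notin> U \<or> (\<exists>u\<in>K. q x u \<le> a))" for x a
      by (cases "x \<in> U") (use pU pA p_in order_trans in blast)+
    then show ?thesis by auto
  qed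
  finally have epi: "closed {(x, a). q x (p x) \<le> a}" .
  have "p x \<in> ball u0 r \<and> f x (p x) \<in> W \<and> q x (p x) \<le> t x" if "x \<in> U" for x
    using pU[OF that] qt[OF that] K XYW[of x "p x"] that by (auto simp: U_def)
  then show ?thesis
    using U p0 p_in loc epi unfolding q_def t_def by blast
qed

section \<open>Costs along input sequences\<close>

lemma continuous_on_cost:
  fixes f :: "nat \<Rightarrow> 's::topological_space \<Rightarrow> 'u::topological_space \<Rightarrow> 's"
  assumes f: "\<And>k. k < n \<Longrightarrow> continuous_on UNIV (\<lambda>(x, u). f k x u)"
    and c: "\<And>k. k < n \<Longrightarrow> continuous_on UNIV (\<lambda>(x, u). c k x u)"
    and cN: "continuous_on UNIV cN"
    and "k + length vs \<le> n"
  shows "continuous_on UNIV (\<lambda>x. cost f c cN k x vs)"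
  using \<open>k + length vs \<le> n\<close>
proof (induction vs arbitrary: k)
  case Nil
  then show ?case using cN by simp
next
  case (Cons v vs)
  have sec: "continuous_on UNIV (\<lambda>x. (x, v))" by (intro continuous_intros)
  have "k < n" using Cons.prems by simp
  then have "continuous_on UNIV (\<lambda>x. f k x v)" "continuous_on UNIV (\<lambda>x. c k x v)"
    using continuous_on_compose2[OF f sec] continuous_on_compose2[OF c sec] by auto
  moreover have "continuous_on UNIV (\<lambda>x. cost f c cN (Suc k) x vs)"
    using Cons by simp
  ultimately show ?case
    by (simp add: continuous_on_add continuous_on_compose2[of UNIV "\<lambda>x. cost f c cN (Suc k) x vs"])
qed

text \<open>The constant \<open>d\<close> is the cost of the stages before \<open>k\<close>. It does
  not depend on the tail, so comparing tails from \<open>xs k\<close> amounts to comparing full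
  sequences.\<close>

lemma cost_take_append:
  assumes "\<And>i. i < length us \<Longrightarrow> xs (Suc i) = f i (xs i) (us ! i)" "k \<le> length us"
  shows "\<exists>d. \<forall>vs. cost f c cN 0 (xs 0) (take k us @ vs) = d + cost f c cN k (xs k) vs"
  using \<open>k \<le> length us\<close>
proof (induction k)
  case 0
  then show ?case by (intro exI[of _ 0]) simp
next
  case (Suc k)
  then obtain d where "\<And>vs. cost f c cN 0 (xs 0) (take k us @ vs) = d + cost f c cN k (xs k) vs"
    by auto
  then have "cost f c cN 0 (xs 0) (take (Suc k) us @ vs) =
      (d + c k (xs k) (us ! k)) + cost f c cN (Suc k) (xs (Suc k)) vs" for vs
    using Suc.prems assms(1)[of k] by (simp add: take_Suc_conv_app_nth)
  then show ?case by blast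
qed

text \<open>Changing the policy at an earlier stage therefore leaves the later cost-to-go functions
  intact.\<close>

lemma J_policy_cong:
  assumes "\<And>i. k \<le> i \<Longrightarrow> i < n \<Longrightarrow> \<pi> i = \<pi>' i"
  shows "J_policy n f c cN \<pi> k x = J_policy n f c cN \<pi>' k x"
  using assms
proof (induction "n - k" arbitrary: k x)
  case 0
  then show ?case by (simp add: J_policy.simps[of _ _ _ _ _ k])
next
  case (Suc d)
  then have "J_policy n f c cN \<pi> (Suc k) y = J_policy n f c cN \<pi>' (Suc k) y" for y by simp
  then show ?case
    using Suc by (simp add: J_policy.simps[of _ _ _ _ _ k])
qed

section \<open>Backward induction over the stages\<close>

lemma twice_continuously_differentiable_imp_continuous:
  "twice_continuously_differentiable g \<Longrightarrow> continuous_on UNIV g"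
  unfolding twice_continuously_differentiable_def
  by (meson continuous_at_imp_continuous_on has_derivative_continuous)

text \<open>The equality of costs is what carries spuriousness from the minimizer over to the
  policy.\<close>

lemma ex_policy_following_minimizer:
  fixes f :: "nat \<Rightarrow> 's::euclidean_space \<Rightarrow> 'u::euclidean_space \<Rightarrow> 's"
  assumes A: "compact A"
    and f: "\<And>k. k < n \<Longrightarrow> continuous_on UNIV (\<lambda>(x, u). f k x u)"
    and c: "\<And>k. k < n \<Longrightarrow> continuous_on UNIV (\<lambda>(x, u). c k x u)"
    and cN: "continuous_on UNIV cN"
    and min: "strict_local_minimizer n A f c cN (xs 0) us"
    and xs: "\<And>k. k < n \<Longrightarrow> xs (Suc k) = f k (xs k) (us ! k)"
  shows "\<exists>\<pi>. locally_minimum_policy n A f c cN \<pi> \<and> (\<forall>k<n. \<pi> k (xs k) = us ! k) \<and>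
    J_policy n f c cN \<pi> 0 (xs 0) = cost f c cN 0 (xs 0) us"
proof -
  have us: "length us = n" "set us \<subseteq> A"
    using min by (auto simp: strict_local_minimizer_def input_seqs_def)
  obtain r where r: "r > 0" and strict: "\<And>vs. length vs = n \<Longrightarrow> vs \<noteq> us \<Longrightarrow>
      (\<And>i. i < n \<Longrightarrow> vs ! i \<in> ball (us ! i) r \<inter> A) \<Longrightarrow>
      cost f c cN 0 (xs 0) us < cost f c cN 0 (xs 0) vs"
    using min unfolding strict_local_minimizer_def by metis
  let ?J = "J_policy n f c cN" and ?Q = "Q_policy n f c cN"
  let ?T = "\<lambda>k x. cost f c cN k x (drop k us)"
  let ?near = "\<lambda>k vs. length vs = n - k \<and> (\<forall>i<n - k. vs ! i \<in> ball (us ! (k + i)) r \<inter> A)"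
  let ?good = "\<lambda>\<pi> i. \<pi> i (xs i) = us ! i \<and> (\<forall>x. \<pi> i x \<in> A \<and>
      (\<exists>e>0. \<forall>v\<in>ball (\<pi> i x) e \<inter> A. ?Q \<pi> i x (\<pi> i x) \<le> ?Q \<pi> i x v))"
  \<comment> \<open>The last conjunct lets the induction use strict minimality: near
    \<open>xs k\<close> the cost-to-go is the cost of an actual input tail within \<open>r\<close>
    of the tail of \<open>us\<close>.\<close>
  have "\<exists>\<pi>. (\<forall>i. k \<le> i \<longrightarrow> i < n \<longrightarrow> ?good \<pi> i)
      \<and> closed {(x, a). ?J \<pi> k x \<le> a} \<and> ?J \<pi> k (xs k) = ?T k (xs k)
      \<and> (\<exists>U. open U \<and> xs k \<in> U \<and>
           (\<forall>y\<in>U. ?J \<pi> k y \<le> ?T k y \<and> (\<exists>vs. ?near k vs \<and> ?J \<pi> k y = cost f c cN k y vs)))"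
    if "k \<le> n" for k
    using that
  proof (induction k rule: inc_induct)
    \<comment> \<open>No inputs remain at stage \<open>n\<close>, so any policy serves and the
      neighbourhood is the whole space.\<close>
    case base
    have "continuous_on UNIV (\<lambda>z::'s \<times> real. cN (fst z))"
      by (rule continuous_on_compose2[OF cN]) (auto intro: continuous_intros)
    then have "closed {z::'s \<times> real. cN (fst z) \<le> snd z}"
      by (intro closed_Collect_le continuous_intros)
    then show ?case
      using us by (intro exI[of _ undefined] conjI exI[of _ UNIV])
        (auto simp: J_policy_terminal case_prod_unfold)
  next
    case (step k)
    then have k: "k < n" by simp
    from step.IH obtain \<pi> W where
      good: "\<And>i. Suc k \<le> i \<Longrightarrow> i < n \<Longrightarrow> ?good \<pi> i"
      and epi: "closed {(x, a). ?J \<pi> (Suc k) x \<le> a}"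
      and J0: "?J \<pi> (Suc k) (xs (Suc k)) = ?T (Suc k) (xs (Suc k))"
      and W: "open W" "xs (Suc k) \<in> W"
      and JW: "\<And>y. y \<in> W \<Longrightarrow> ?J \<pi> (Suc k) y \<le> ?T (Suc k) y"
      and near: "\<And>y. y \<in> W \<Longrightarrow> \<exists>vs. ?near (Suc k) vs \<and> ?J \<pi> (Suc k) y = cost f c cN (Suc k) y vs"
      by blast
    have T_step: "?T k x = c k x (us ! k) + ?T (Suc k) (f k x (us ! k))" for x
      using k us by (simp add: Cons_nth_drop_Suc[symmetric])
    have near_Cons: "?near k (u # vs)" if "?near (Suc k) vs" "u \<in> A" "u \<in> ball (us ! k) r" for u vs
      using that k by (auto simp: nth_Cons split: nat.split)
    obtain d where d: "\<And>vs. cost f c cN 0 (xs 0) (take k us @ vs) = d + cost f c cN k (xs k) vs"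
      using cost_take_append[of us xs f k c cN] xs us k by auto
    \<comment> \<open>The competitor follows \<open>us\<close> before stage \<open>k\<close>,
      applies \<open>u\<close>, and then uses the closed-loop inputs \<open>vs\<close> supplied by
      \<open>near\<close>. It stays within \<open>r\<close> of \<open>us\<close> and differs from it
      at index \<open>k\<close>.\<close>
    have tail_strict: "c k (xs k) (us ! k) + ?J \<pi> (Suc k) (f k (xs k) (us ! k))
        < c k (xs k) u + ?J \<pi> (Suc k) (f k (xs k) u)"
      if u: "u \<in> A" "u \<in> ball (us ! k) r" "u \<noteq> us ! k" "f k (xs k) u \<in> W" for u
    proof -
      obtain vs where vs: "?near (Suc k) vs" "?J \<pi> (Suc k) (f k (xs k) u) = cost f c cN (Suc k) (f k (xs k) u) vs"
        using near[OF u(4)] by blast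
      have nk: "?near k (u # vs)" by (rule near_Cons) (use vs u in auto)
      let ?ws = "take k us @ u # vs"
      have "cost f c cN 0 (xs 0) us < cost f c cN 0 (xs 0) ?ws"
      proof (rule strict)
        show "length ?ws = n" using nk us k by simp
        have "?ws ! k \<noteq> us ! k" using u us k by (simp add: nth_append)
        then show "?ws \<noteq> us" by auto
        fix i assume i: "i < n"
        show "?ws ! i \<in> ball (us ! i) r \<inter> A"
        proof (cases "i < k")
          case True
          then show ?thesis using us i r by (auto simp: nth_append)
        next
          case False
          then have "?ws ! i = (u # vs) ! (i - k)" using us k by (simp add: nth_append)
          then show ?thesis using nk False i by (metis diff_less_mono le_add_diff_inverse not_le)
        qed
      qed
      moreover have "cost f c cN 0 (xs 0) us = d + ?T k (xs k)"
        using d[of "drop k us"] by simp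
      ultimately show ?thesis
        using d[of "u # vs"] vs(2) J0 T_step[of "xs k"] xs[OF k] by simp
    qed
    have uk: "us ! k \<in> A" using us k by auto
    have contT: "continuous_on UNIV (?T (Suc k))"
      by (rule continuous_on_cost[where n=n and f=f]) (use f c cN us k in auto)
    obtain p U where p: "open U" "xs k \<in> U" "p (xs k) = us ! k" "\<And>x. p x \<in> A"
      "\<And>x. \<exists>e>0. \<forall>v\<in>ball (p x) e \<inter> A. c k x (p x) + ?J \<pi> (Suc k) (f k x (p x))
          \<le> c k x v + ?J \<pi> (Suc k) (f k x v)"
      "closed {(x, a). c k x (p x) + ?J \<pi> (Suc k) (f k x (p x)) \<le> a}"
      "\<And>x. x \<in> U \<Longrightarrow> p x \<in> ball (us ! k) r \<and> f k x (p x) \<in> W \<and>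
          c k x (p x) + ?J \<pi> (Suc k) (f k x (p x)) \<le> c k x (us ! k) + ?T (Suc k) (f k x (us ! k))"
      using policy_step[OF A uk f[OF k] c[OF k] epi contT W(1), of "xs k" r]
        W(2) JW J0 xs[OF k] r tail_strict by auto
    \<comment> \<open>Only stage \<open>k\<close> is overwritten, so the properties of later stages
      carry over through \<open>J_same\<close>.\<close>
    define \<pi>' where "\<pi>' = \<pi>(k := p)"
    have J_same: "?J \<pi>' i = ?J \<pi> i" if "Suc k \<le> i" for i
      by (rule ext, rule J_policy_cong) (use that in \<open>auto simp: \<pi>'_def\<close>)
    have J_k: "?J \<pi>' k x = c k x (p x) + ?J \<pi> (Suc k) (f k x (p x))" for x
      using k by (simp add: J_policy_step Q_policy_def J_same) (simp add: \<pi>'_def)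
    have "?good \<pi>' i" if "k \<le> i" "i < n" for i
    proof (cases "i = k")
      case True
      then show ?thesis
        using p(3-5) by (simp add: Q_policy_def J_same) (simp add: \<pi>'_def)
    next
      case False
      then show ?thesis
        using good[of i] that by (simp add: Q_policy_def J_same) (simp add: \<pi>'_def)
    qed
    moreover have "closed {(x, a). ?J \<pi>' k x \<le> a}" using p(6) by (simp add: J_k)
    moreover have "?J \<pi>' k (xs k) = ?T k (xs k)"
      using J0 xs[OF k] p(3) by (simp add: J_k T_step)
    moreover have "?J \<pi>' k y \<le> ?T k y \<and> (\<exists>vs. ?near k vs \<and> ?J \<pi>' k y = cost f c cN k y vs)"
      if y: "y \<in> U" for y
    proof
      show "?J \<pi>' k y \<le> ?T k y" using p(7)[OF y] by (simp add: J_k T_step)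
      obtain vs where vs: "?near (Suc k) vs"
          "?J \<pi> (Suc k) (f k y (p y)) = cost f c cN (Suc k) (f k y (p y)) vs"
        using near p(7)[OF y] by blast
      have "?near k (p y # vs)" by (rule near_Cons) (use vs p(4) p(7)[OF y] in auto)
      moreover have "?J \<pi>' k y = cost f c cN k y (p y # vs)" using vs(2) by (simp add: J_k)
      ultimately show "\<exists>vs. ?near k vs \<and> ?J \<pi>' k y = cost f c cN k y vs" by blast
    qed
    ultimately show ?case using p(1,2) by blast
  qed
  from this[of 0] obtain \<pi> where "\<And>i. i < n \<Longrightarrow> ?good \<pi> i" "?J \<pi> 0 (xs 0) = ?T 0 (xs 0)"
    by auto
  then show ?thesis
    by (intro exI[of _ \<pi>]) (simp add: locally_minimum_policy_def control_policy_def)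
qed

theorem theorem3:
  fixes n :: nat
    and A :: "(real ^ 'm) set"
    and f :: "nat \<Rightarrow> real ^ 's \<Rightarrow> real ^ 'm \<Rightarrow> real ^ 's"
    and c :: "nat \<Rightarrow> real ^ 's \<Rightarrow> real ^ 'm \<Rightarrow> real"
    and cN :: "real ^ 's \<Rightarrow> real"
    and x0 :: "real ^ 's"
    and us :: "(real ^ 'm) list"
    and xs :: "nat \<Rightarrow> real ^ 's"
  assumes "compact A"
    and "\<And>k. k < n \<Longrightarrow> twice_continuously_differentiable (\<lambda>(x, u). f k x u)"
    and "\<And>k. k < n \<Longrightarrow> twice_continuously_differentiable (\<lambda>(x, u). c k x u)"
    and "twice_continuously_differentiable cN"
    and "strict_local_minimizer n A f c cN x0 us"
    and "xs 0 = x0"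
    and "\<And>k. k < n \<Longrightarrow> xs (Suc k) = f k (xs k) (us ! k)"
  shows "(\<exists>\<pi>. locally_minimum_policy n A f c cN \<pi> \<and> (\<forall>k<n. \<pi> k (xs k) = us ! k)) \<and>
    (spurious_strict_local_minimizer n A f c cN x0 us \<longrightarrow>
       (\<exists>\<pi>. spurious_locally_minimum_policy n A f c cN x0 \<pi> \<and> (\<forall>k<n. \<pi> k (xs k) = us ! k)))"
proof -
  \<comment> \<open>One policy serves both claims, as its cost from \<open>x0\<close> is exactly
    that of \<open>us\<close>.\<close>
  obtain \<pi> where "locally_minimum_policy n A f c cN \<pi>" "\<forall>k<n. \<pi> k (xs k) = us ! k"
    "J_policy n f c cN \<pi> 0 (xs 0) = cost f c cN 0 (xs 0) us"
    using ex_policy_following_minimizer[of A n f c cN xs us] assms(1,5,6,7)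
      assms(2-4)[THEN twice_continuously_differentiable_imp_continuous] by auto
  then show ?thesis
    using \<open>xs 0 = x0\<close>
    unfolding spurious_locally_minimum_policy_def spurious_strict_local_minimizer_def by auto
qed

end
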